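(* Let $\mathsf{A}\in\mathbb{R}^{J_1\times J_1\times\cdots\times J_N\times J_N}$ and $\mathsf{B}\in\mathbb{R}^{J_1\times K_1\times\cdots\times J_N\times K_N}$, and let $$\mathscr{R}=\begin{vmatrix}\mathsf{B}&\mathsf{A}*\mathsf{B}&\cdots&\mathsf{A}^{\Pi_{\mathcal{J}}-1}*\mathsf{B}\end{vmatrix}\in\mathbb{R}^{J_1\times J_1K_1\times\cdots\times J_N\times J_NK_N}$$ be the reachability tensor, where $\Pi_{\mathcal{J}}=\prod_{n=1}^NJ_n$. If, for some odd $n\in\{1,3,\dots,2N-1\}$, the set of $n$-mode singular values of $\mathscr{R}$ obtained from its higher-order singular value decomposition (HOSVD) contains zero, then the pair $(\mathsf{A},\mathsf{B})$ is not reachable.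
   Context: Einstein products: $(\mathsf{A}*\mathsf{X})_{j_1\cdots j_N}=\sum_{i_1,\dots,i_N}\mathsf{A}_{j_1i_1\cdots j_Ni_N}\mathsf{X}_{i_1\cdots i_N}$ for an $N$-th order $\mathsf{X}$, and $(\mathsf{A}*\mathsf{B})_{j_1i_1\cdots j_Ni_N}=\sum_{k_1,\dots,k_N}\mathsf{A}_{j_1k_1\cdots j_Nk_N}\mathsf{B}_{k_1i_1\cdots k_Ni_N}$ for even-order paired tensors; $\mathsf{A}^k$ is the $k$-fold Einstein product, $\mathsf{A}^0$ being the identity tensor for $*$. The pair $(\mathsf{A},\mathsf{B})$ is reachable on $[t_0,t_1]$ ($t_0<t_1$ integers) if for any $\mathsf{X}_0,\mathsf{X}_1\in\mathbb{R}^{J_1\times\cdots\times J_N}$ there are inputs $\mathsf{U}_t\in\mathbb{R}^{K_1\times\cdots\times K_N}$, $t_0\le t\le t_1-1$, steering $\mathsf{X}_{t+1}=\mathsf{A}*\mathsf{X}_t+\mathsf{B}*\mathsf{U}_t$ from $\mathsf{X}_{t_0}=\mathsf{X}_0$ to $\mathsf{X}_{t_1}=\mathsf{X}_1$. The pair is reachable if it is reachable on some interval $[t_0,t_1]$. Mode row block tensor: given $P=P_1\cdots P_N$ tensors $\mathsf{Z}_1,\dots,\mathsf{Z}_P\in\mathbb{R}^{J_1\times K_1\times\cdots\times J_N\times K_N}$, the tensor $\begin{vmatrix}\mathsf{Z}_1&\cdots&\mathsf{Z}_P\end{vmatrix}\in\mathbb{R}^{J_1\times K_1P_1\times\cdots\times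 J_N\times K_NP_N}$ is obtained by concatenating consecutive groups of $P_1$ tensors along the second index of the first pair, then consecutive groups of $P_2$ of the results along the second index of the second pair, and so on; explicitly its entry at $(j_1,l_1,\dots,j_N,l_N)$ with $l_n=(p_n-1)K_n+k_n$, $1\le k_n\le K_n$, $1\le p_n\le P_n$, is $(\mathsf{Z}_p)_{j_1k_1\cdots j_Nk_N}$ with $p=p_1+\sum_{n=2}^N(p_n-1)\prod_{l=1}^{n-1}P_l$. For $\mathscr{R}$ one takes $P_n=J_n$ and $\mathsf{Z}_p=\mathsf{A}^{p-1}*\mathsf{B}$. HOSVD: a tensor $\mathsf{Y}\in\mathbb{R}^{L_1\times\cdots\times L_M}$ is written $\mathsf{Y}=\mathsf{S}\times_1\mathbf{U}_1\times_2\cdots\times_M\mathbf{U}_M$ with $\mathbf{U}_n\in\mathbb{R}^{L_n\times L_n}$ orthogonal, where $(\mathsf{S}\times_n\mathbf{U})_{l_1\cdots i\cdots l_M}=\sum_{l_n}\mathsf{S}_{l_1\cdots l_n\cdots l_M}\mathbf{U}_{il_n}$ ($i$ in position $n$), and $\mathsf{S}\in\mathbb{R}^{L_1\times\cdots\times L_M}$ is such that, writing $\mathsf{S}_{l_n=\alpha}$ for the subtensor with $n$-th index fixed to $\alpha$, (i) $\mathsf{S}_{l_n=\alpha}$ and $\mathsf{S}_{l_n=\beta}$ are orthogonal for all $n$ and $\alpha\ne\beta$; (ii) $\|\mathsf{S}_{l_n=1}\|\ge\cdots\ge\|\mathsf{S}_{l_n=L_n}\|\ge0$ (Frobenius norms)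 for all $n$. The $n$-mode singular values of $\mathsf{Y}$ are $\|\mathsf{S}_{l_n=j}\|$, $j=1,\dots,L_n$. *)

theory Defs
  imports Complex_Main "Jordan_Normal_Form.Matrix"
begin

text \<open>
  Tensors of variable order. The dimensions of a tensor form a list; an entry is addressed by a
  list of indices. Indices and mode numbers are counted from 0 throughout this theory: the
  \<open>n\<close>-th mode in the usual one-based count is mode \<open>n - 1\<close>. Tensors of
  dimensions \<open>ds\<close> are the functions vanishing outside \<open>indices ds\<close>, so that equality of tensors is
  equality of functions.

  A paired tensor over \<open>J\<^sub>1 \<times> K\<^sub>1 \<times> \<dots> \<times> J\<^sub>N \<times> K\<^sub>N\<close> has the dimension list \<open>splice J K\<close>, and its entry at
  \<open>(j\<^sub>1, k\<^sub>1, \<dots>, j\<^sub>N, k\<^sub>N)\<close> is its value at \<open>splice j k\<close>.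
\<close>

type_synonym tensor = "nat list \<Rightarrow> real"

definition indices :: "nat list \<Rightarrow> nat list set" where
  "indices ds = {i. list_all2 (<) i ds}"

definition tensors :: "nat list \<Rightarrow> tensor set" where
  "tensors ds = {X. \<forall>i. i \<notin> indices ds \<longrightarrow> X i = 0}"

definition fst_indices :: "nat list \<Rightarrow> nat list" where
  "fst_indices l = nths l {m. even m}"

definition snd_indices :: "nat list \<Rightarrow> nat list" where
  "snd_indices l = nths l {m. odd m}"

lemma fst_snd_indices_splice:
  assumes "length j = length k"
  shows "fst_indices (splice j k) = j" and "snd_indices (splice j k) = k"
  using assms
  by (induction j k rule: list_induct2)
     (simp_all add: fst_indices_def snd_indices_def nths_Cons)


subsection \<open>Einstein products\<close>

text \<open>\<open>einstein_app J I A X\<close> is \<open>A * X\<close> for \<open>A\<close> with dimensions \<open>splice J I\<close> and \<open>X\<close> with dimensions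
  \<open>I\<close>; \<open>einstein_mult J K I A B\<close> is \<open>A * B\<close> for \<open>A\<close> with dimensions \<open>splice J K\<close> and \<open>B\<close> with
  dimensions \<open>splice K I\<close>.\<close>

definition einstein_app :: "nat list \<Rightarrow> nat list \<Rightarrow> tensor \<Rightarrow> tensor \<Rightarrow> tensor" where
  "einstein_app J I A X =
     (\<lambda>j. if j \<in> indices J then \<Sum>i\<in>indices I. A (splice j i) * X i else 0)"

definition einstein_mult :: "nat list \<Rightarrow> nat list \<Rightarrow> nat list \<Rightarrow> tensor \<Rightarrow> tensor \<Rightarrow> tensor" where
  "einstein_mult J K I A B =
     (\<lambda>l. if l \<in> indices (splice J I)
          then \<Sum>k\<in>indices K. A (splice (fst_indices l) k) * B (splice k (snd_indices l))
          else 0)"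

definition identity_tensor :: "nat list \<Rightarrow> tensor" where
  "identity_tensor J =
     (\<lambda>l. if l \<in> indices (splice J J) \<and> fst_indices l = snd_indices l then 1 else 0)"

primrec einstein_pow :: "nat list \<Rightarrow> tensor \<Rightarrow> nat \<Rightarrow> tensor" where
  "einstein_pow J A 0 = identity_tensor J"
| "einstein_pow J A (Suc k) = einstein_mult J J J A (einstein_pow J A k)"


subsection \<open>Reachability\<close>

definition reachable_on ::
  "nat list \<Rightarrow> nat list \<Rightarrow> tensor \<Rightarrow> tensor \<Rightarrow> int \<Rightarrow> int \<Rightarrow> bool" where
  "reachable_on J K A B t0 t1 \<longleftrightarrow>
     (\<forall>X0\<in>tensors J. \<forall>X1\<in>tensors J.
        \<exists>(U :: int \<Rightarrow> tensor) (X :: int \<Rightarrow> tensor).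
          (\<forall>t\<in>{t0..t1 - 1}. U t \<in> tensors K) \<and>
          X t0 = X0 \<and> X t1 = X1 \<and>
          (\<forall>t\<in>{t0..t1 - 1}. X (t + 1) =
             (\<lambda>j. einstein_app J J A (X t) j + einstein_app J K B (U t) j)))"

definition reachable :: "nat list \<Rightarrow> nat list \<Rightarrow> tensor \<Rightarrow> tensor \<Rightarrow> bool" where
  "reachable J K A B \<longleftrightarrow> (\<exists>t0 t1. t0 < t1 \<and> reachable_on J K A B t0 t1)"


subsection \<open>Mode row block tensors\<close>

text \<open>The position, in the sequence of blocks, of the block with multi-index \<open>p\<close>; the first
  component varies fastest.\<close>

definition block_position :: "nat list \<Rightarrow> nat list \<Rightarrow> nat" where
  "block_position P p = (\<Sum>m<length P. p ! m * (\<Prod>l<m. P ! l))"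

text \<open>A second index \<open>l\<^sub>m < P\<^sub>m K\<^sub>m\<close> of the block tensor decomposes as \<open>l\<^sub>m = p\<^sub>m K\<^sub>m + k\<^sub>m\<close> with
  \<open>k\<^sub>m < K\<^sub>m\<close>, \<open>p\<^sub>m < P\<^sub>m\<close>.\<close>

definition row_block_tensor ::
  "nat list \<Rightarrow> nat list \<Rightarrow> nat list \<Rightarrow> (nat \<Rightarrow> tensor) \<Rightarrow> tensor" where
  "row_block_tensor J K P Z =
     (\<lambda>l. if l \<in> indices (splice J (map2 (*) P K))
          then Z (block_position P (map2 (div) (snd_indices l) K))
                 (splice (fst_indices l) (map2 (mod) (snd_indices l) K))
          else 0)"

definition reachability_tensor :: "nat list \<Rightarrow> nat list \<Rightarrow> tensor \<Rightarrow> tensor \<Rightarrow> tensor" where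
  "reachability_tensor J K A B =
     row_block_tensor J K J (\<lambda>p. einstein_mult J J K (einstein_pow J A p) B)"


subsection \<open>Higher-order singular value decomposition\<close>

definition tensor_inner :: "nat list \<Rightarrow> tensor \<Rightarrow> tensor \<Rightarrow> real" where
  "tensor_inner ds X Y = (\<Sum>i\<in>indices ds. X i * Y i)"

definition tensor_norm :: "nat list \<Rightarrow> tensor \<Rightarrow> real" where
  "tensor_norm ds X = sqrt (\<Sum>i\<in>indices ds. (X i)\<^sup>2)"

definition drop_mode :: "nat \<Rightarrow> nat list \<Rightarrow> nat list" where
  "drop_mode m ds = take m ds @ drop (Suc m) ds"

text \<open>The subtensor of \<open>S\<close> with index \<open>m\<close> fixed to \<open>\<alpha>\<close>, a tensor of dimensions \<open>drop_mode m ds\<close>.\<close>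

definition subtensor :: "tensor \<Rightarrow> nat \<Rightarrow> nat \<Rightarrow> tensor" where
  "subtensor S m \<alpha> = (\<lambda>i. S (take m i @ \<alpha> # drop m i))"

definition mode_product :: "nat list \<Rightarrow> nat \<Rightarrow> tensor \<Rightarrow> real mat \<Rightarrow> tensor" where
  "mode_product ds m S U =
     (\<lambda>l. if l \<in> indices (ds[m := dim_row U])
          then \<Sum>i<ds ! m. S (l[m := i]) * U $$ (l ! m, i) else 0)"

text \<open>The library's \<open>orthogonal_mat\<close> only requires pairwise orthogonal nonzero columns, hence the
  explicit conditions on \<open>U m\<close>. As the \<open>U m\<close> are square, \<open>ds\<close> remains the dimension list at every
  stage of the fold.\<close>

definition hosvd :: "nat list \<Rightarrow> tensor \<Rightarrow> tensor \<Rightarrow> (nat \<Rightarrow> real mat) \<Rightarrow> bool" where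
  "hosvd ds Y S U \<longleftrightarrow>
     S \<in> tensors ds \<and>
     (\<forall>m<length ds. U m \<in> carrier_mat (ds ! m) (ds ! m) \<and>
        U m * transpose_mat (U m) = 1\<^sub>m (ds ! m) \<and>
        transpose_mat (U m) * U m = 1\<^sub>m (ds ! m)) \<and>
     Y = fold (\<lambda>m T. mode_product ds m T (U m)) [0..<length ds] S \<and>
     (\<forall>m<length ds. \<forall>\<alpha><ds ! m. \<forall>\<beta><ds ! m. \<alpha> \<noteq> \<beta> \<longrightarrow>
        tensor_inner (drop_mode m ds) (subtensor S m \<alpha>) (subtensor S m \<beta>) = 0) \<and>
     (\<forall>m<length ds. \<forall>\<alpha><ds ! m. \<forall>\<beta><ds ! m. \<alpha> \<le> \<beta> \<longrightarrow>
        tensor_norm (drop_mode m ds) (subtensor S m \<alpha>)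
          \<ge> tensor_norm (drop_mode m ds) (subtensor S m \<beta>))"

text \<open>The mode-\<open>m\<close> singular values of a tensor of dimensions \<open>ds\<close>, read off from the core tensor \<open>S\<close>
  of an HOSVD of it.\<close>

definition mode_singular_values :: "nat list \<Rightarrow> tensor \<Rightarrow> nat \<Rightarrow> real set" where
  "mode_singular_values ds S m =
     {tensor_norm (drop_mode m ds) (subtensor S m \<alpha>) | \<alpha>. \<alpha> < ds ! m}"

end

theory Submission
  imports Defs
begin

text \<open>
  Let \<open>q\<close> be the pair whose first index is the given mode. If the core subtensor with index
  \<open>\<alpha>\<close> in that mode vanishes, then column \<open>\<alpha>\<close> of the corresponding orthogonal factor annihilates the
  reachability tensor in that mode. Placing this column along the \<open>q\<close>-th axis gives a nonzero
  covector \<open>w\<close> with \<open>w * A\<^sup>p * B = 0\<close> for all \<open>p\<close> below the dimension of the state space, hence, as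
  the covectors \<open>w * A\<^sup>p\<close> are linearly dependent, for all \<open>p\<close>. So every trajectory starting at \<open>0\<close>
  stays in the kernel of \<open>w\<close>.
\<close>

subsection \<open>Index lists\<close>

lemma indices_Nil [simp]: "indices [] = {[]}"
  by (simp add: indices_def)

lemma Cons_in_indices [simp]: "x # xs \<in> indices (d # ds) \<longleftrightarrow> x < d \<and> xs \<in> indices ds"
  by (simp add: indices_def)

lemma indices_Cons: "indices (d # ds) = (\<lambda>(x, xs). x # xs) ` ({..<d} \<times> indices ds)"
  by (auto simp: indices_def list_all2_Cons2 image_iff)

lemma finite_indices [simp]: "finite (indices ds)"
  by (induction ds) (simp_all add: indices_Cons)

text \<open>Identifies the dimension of the state space with the number of blocks in the
  reachability tensor.\<close>

lemma card_indices: "card (indices ds) = prod_list ds"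
proof (induction ds)
  case (Cons d ds)
  have "inj_on (\<lambda>(x, xs). x # xs) ({..<d} \<times> indices ds)"
    by (auto simp: inj_on_def)
  then show ?case
    using Cons by (simp add: indices_Cons card_image)
qed simp

lemma length_indices: "i \<in> indices ds \<Longrightarrow> length i = length ds"
  by (simp add: indices_def list_all2_lengthD)

lemma indices_nth_less: "i \<in> indices ds \<Longrightarrow> m < length ds \<Longrightarrow> i ! m < ds ! m"
  by (simp add: indices_def list_all2_conv_all_nth)

lemma list_update_in_indices:
  "i \<in> indices ds \<Longrightarrow> x < ds ! m \<Longrightarrow> i[m := x] \<in> indices ds"
  by (cases "m < length ds")
     (auto simp: indices_def list_all2_conv_all_nth nth_list_update list_update_beyond)

lemma splice_in_indices:
  assumes "length J = length I" and "j \<in> indices J" and "i \<in> indices I"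
  shows "splice j i \<in> indices (splice J I)"
  using assms
proof (induction J I arbitrary: i j rule: list_induct2)
  case (Cons d J e I)
  then show ?case by (cases i; cases j) (auto simp: indices_def)
qed simp

lemma splice_nth_even:
  "length j = length k \<Longrightarrow> q < length j \<Longrightarrow> splice j k ! (2 * q) = j ! q"
proof (induction j k arbitrary: q rule: list_induct2)
  case (Cons a j b k)
  then show ?case by (cases q) auto
qed simp

lemma splice_update_even:
  "length j = length k \<Longrightarrow> (splice j k)[2 * q := x] = splice (j[q := x]) k"
proof (induction j k arbitrary: q rule: list_induct2)
  case (Cons a j b k)
  then show ?case by (cases q) auto
qed simp

lemma drop_mode_in_indices:
  "l \<in> indices ds \<Longrightarrow> drop_mode m l \<in> indices (drop_mode m ds)"
  unfolding indices_def drop_mode_def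
  by (auto intro!: list_all2_appendI list_all2_takeI list_all2_dropI)

lemma insert_drop_mode:
  "m < length l \<Longrightarrow> take m (drop_mode m l) @ l ! m # drop m (drop_mode m l) = l"
  by (simp add: drop_mode_def min_def id_take_nth_drop[symmetric])

section \<open>Mixed-radix numbering of blocks\<close>

lemma block_position_Cons:
  "block_position (d # P) (x # p) = x + d * block_position P p"
  by (simp add: block_position_def sum.lessThan_Suc_shift prod.lessThan_Suc_shift
      sum_distrib_left mult_ac del: sum.lessThan_Suc prod.lessThan_Suc)

text \<open>Mixed-radix expansion with the least significant digit first: \<open>n mod d\<close> is
  the leading digit and \<open>n div d\<close> is expanded in the remaining radices.\<close>

lemma block_position_surj:
  "n < prod_list P \<Longrightarrow> \<exists>p\<in>indices P. block_position P p = n"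
proof (induction P arbitrary: n)
  case Nil
  then show ?case by (simp add: block_position_def)
next
  case (Cons d P)
  then have "d > 0" and "n div d < prod_list P"
    by (auto simp: less_mult_imp_div_less mult.commute intro: gr0I)
  with Cons.IH obtain p where "p \<in> indices P" "block_position P p = n div d"
    by blast
  with \<open>d > 0\<close> have "n mod d # p \<in> indices (d # P)"
    and "block_position (d # P) (n mod d # p) = n"
    by (simp_all add: block_position_Cons)
  then show ?case by blast
qed

text \<open>Division with remainder in each component: \<open>s\<close> has the components
  \<open>p * K + k\<close>.\<close>

lemma block_index_exists:
  assumes "length P = length K" and "p \<in> indices P" and "k \<in> indices K"
  shows "\<exists>s\<in>indices (map2 (*) P K). map2 (div) s K = p \<and> map2 (mod) s K = k"
  using assms
proof (induction P K arbitrary: p k rule: list_induct2)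
  case (Cons d P e K)
  from Cons.prems obtain a p' b k' where pk: "p = a # p'" "k = b # k'"
    by (cases p; cases k) (auto simp: indices_def)
  with Cons obtain s where s: "s \<in> indices (map2 (*) P K)"
    "map2 (div) s K = p'" "map2 (mod) s K = k'"
    by fastforce
  have ab: "a < d" "b < e" using Cons.prems pk by auto
  have "a * e + b < Suc a * e" using ab by simp
  also have "\<dots> \<le> d * e" using ab by (intro mult_right_mono) auto
  finally have "(a * e + b) # s \<in> indices (map2 (*) (d # P) (e # K))" using s by simp
  moreover have "map2 (div) ((a * e + b) # s) (e # K) = p"
    "map2 (mod) ((a * e + b) # s) (e # K) = k"
    using ab s pk by simp_all
  ultimately show ?case by blast
qed simp


subsection \<open>Linear recurrences from a finite-dimensional space\<close>

text \<open>A homogeneous system with more unknowns than equations has a nontrivial solution;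
  Gaussian elimination removes one equation and one unknown at a time.\<close>

lemma linear_dependence_card:
  fixes f :: "'p \<Rightarrow> 'i \<Rightarrow> real"
  assumes "finite I" and "finite P" and "card I < card P"
  shows "\<exists>c. (\<exists>p\<in>P. c p \<noteq> 0) \<and> (\<forall>i\<in>I. (\<Sum>p\<in>P. c p * f p i) = 0)"
  using assms
proof (induction I arbitrary: P f rule: finite_induct)
  case empty
  then have "P \<noteq> {}" by auto
  then show ?case by (intro exI[of _ "\<lambda>_. 1"]) auto
next
  case (insert a I)
  show ?case
  proof (cases "\<forall>p\<in>P. f p a = 0")
    case True
    then show ?thesis
      using insert.IH[of P f] insert.prems insert.hyps by auto
  next
    case False
    then obtain r where r: "r \<in> P" "f r a \<noteq> 0" by blast
    \<comment> \<open>The pivot \<open>f r\<close> is used to clear coordinate \<open>a\<close> of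
      every other vector.\<close>
    define g where "g p i = f p i - f p a / f r a * f r i" for p i
    have "card I < card (P - {r})"
      using insert.prems insert.hyps r by simp
    then obtain c where c: "\<exists>p\<in>P - {r}. c p \<noteq> 0" "\<forall>i\<in>I. (\<Sum>p\<in>P - {r}. c p * g p i) = 0"
      using insert.IH[of "P - {r}" g] insert.prems by auto
    \<comment> \<open>The coefficient at \<open>r\<close> collects the pivot multiples subtracted in
      \<open>g\<close>, so that the combination of \<open>f\<close> equals the one of
      \<open>g\<close>.\<close>
    define d where "d = c(r := - (\<Sum>p\<in>P - {r}. c p * (f p a / f r a)))"
    have "(\<Sum>p\<in>P. d p * f p i) = (\<Sum>p\<in>P - {r}. c p * g p i)" for i
    proof -
      have "(\<Sum>p\<in>P. d p * f p i) = d r * f r i + (\<Sum>p\<in>P - {r}. d p * f p i)"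
        using r insert.prems by (simp add: sum.remove[of P r])
      also have "(\<Sum>p\<in>P - {r}. d p * f p i) = (\<Sum>p\<in>P - {r}. c p * f p i)"
        by (intro sum.cong) (auto simp: d_def)
      finally have "(\<Sum>p\<in>P. d p * f p i) = d r * f r i + (\<Sum>p\<in>P - {r}. c p * f p i)" .
      then show ?thesis
        by (simp add: d_def g_def right_diff_distrib sum_subtractf sum_distrib_right mult.assoc)
    qed
    moreover have "(\<Sum>p\<in>P - {r}. c p * g p a) = 0"
      using r by (simp add: g_def)
    moreover have "\<exists>p\<in>P. d p \<noteq> 0"
      using c(1) by (auto simp: d_def)
    ultimately show ?thesis
      using c(2) by (intro exI[of _ d]) auto
  qed
qed

text \<open>Takes the place of Cayley-Hamilton: a linear relation among \<open>w 0\<close>, ...,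
  \<open>w (card I)\<close> propagates under \<open>M\<close>, so the pairings with \<open>b\<close>
  obey a linear recurrence of order at most \<open>card I\<close> whose initial values
  vanish.\<close>

lemma krylov_annihilation:
  fixes w :: "nat \<Rightarrow> 'i \<Rightarrow> real" and M :: "'i \<Rightarrow> 'i \<Rightarrow> real"
  assumes fin: "finite I"
    and step: "\<And>p i. i \<in> I \<Longrightarrow> w (Suc p) i = (\<Sum>j\<in>I. w p j * M j i)"
    and init: "\<And>p. p < card I \<Longrightarrow> (\<Sum>j\<in>I. w p j * b j) = 0"
  shows "(\<Sum>j\<in>I. w p j * b j) = 0"
proof -
  obtain c where c: "\<exists>p\<in>{..card I}. c p \<noteq> 0"
    "\<forall>i\<in>I. (\<Sum>p\<le>card I. c p * w p i) = 0"
    using linear_dependence_card[of I "{..card I}" w] fin by auto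
  \<comment> \<open>The last nonzero coefficient, so that the relation can be solved for
    \<open>w r\<close>. If \<open>r = 0\<close>, the sums over \<open>p < r\<close> are empty and
    \<open>w\<close> vanishes on \<open>I\<close>.\<close>
  define r where "r = Max {p. p \<le> card I \<and> c p \<noteq> 0}"
  have "r \<in> {p. p \<le> card I \<and> c p \<noteq> 0}"
    unfolding r_def using c(1) by (intro Max_in) auto
  then have r: "r \<le> card I" "c r \<noteq> 0" by auto
  have above: "c p = 0" if "p \<in> {..card I} - {..r}" for p
    using that Max_ge[of "{p. p \<le> card I \<and> c p \<noteq> 0}" p] by (auto simp: r_def)
  define a where "a p = - c p / c r" for p
  have base: "w r i = (\<Sum>p<r. a p * w p i)" if "i \<in> I" for i
  proof -
    have "(\<Sum>p\<le>card I. c p * w p i) = (\<Sum>p\<le>r. c p * w p i)"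
      using r above by (intro sum.mono_neutral_right) auto
    also have "\<dots> = (\<Sum>p<r. c p * w p i) + c r * w r i"
      by (simp flip: lessThan_Suc_atMost)
    finally have "c r * w r i = - (\<Sum>p<r. c p * w p i)"
      using c(2) that by simp
    then have "w r i = - (\<Sum>p<r. c p * w p i) / c r"
      using r by (simp add: field_simps)
    then show ?thesis
      by (simp add: a_def sum_divide_distrib sum_negf)
  qed
  have rec: "\<forall>i\<in>I. w (t + r) i = (\<Sum>p<r. a p * w (t + p) i)" for t
  proof (induction t)
    case 0
    then show ?case using base by simp
  next
    case (Suc t)
    show ?case
    proof
      fix i assume i: "i \<in> I"
      have "w (Suc t + r) i = (\<Sum>j\<in>I. (\<Sum>p<r. a p * w (t + p) j) * M j i)"
        using step[OF i, of "t + r"] Suc by simp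
      also have "\<dots> = (\<Sum>p<r. a p * (\<Sum>j\<in>I. w (t + p) j * M j i))"
        by (simp add: sum_distrib_left sum_distrib_right mult_ac sum.swap[of _ I])
      finally show "w (Suc t + r) i = (\<Sum>p<r. a p * w (Suc t + p) i)"
        using step[OF i] by simp
    qed
  qed
  show ?thesis
  proof (induction p rule: less_induct)
    case (less p)
    show ?case
    proof (cases "p < card I")
      case False
      \<comment> \<open>Here \<open>p\<close> is at least \<open>card I\<close>, hence at least
        \<open>r\<close>; the recurrence expresses \<open>w p\<close> by \<open>w (t + s)\<close>
        with \<open>s < r\<close>, all covered by the induction hypothesis.\<close>
      then obtain t where t: "p = t + r"
        using r by (metis le_add_diff_inverse2 le_trans not_less)
      have "(\<Sum>j\<in>I. w p j * b j) = (\<Sum>j\<in>I. (\<Sum>s<r. a s * w (t + s) j) * b j)"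
        using rec t by simp
      also have "\<dots> = (\<Sum>s<r. a s * (\<Sum>j\<in>I. w (t + s) j * b j))"
        by (simp add: sum_distrib_left sum_distrib_right mult_ac sum.swap[of _ I])
      also have "\<dots> = 0"
        using less t by simp
      finally show ?thesis .
    qed (rule init)
  qed
qed


subsection \<open>Covectors and trajectories\<close>

text \<open>The row-vector product \<open>w * A\<close>, adjoint to \<open>einstein_app\<close>. It
  is not cut off outside the index set, so the comparisons with \<open>einstein_mult\<close> and
  \<open>einstein_pow\<close> hold at valid indices.\<close>

definition covector_app :: "nat list \<Rightarrow> tensor \<Rightarrow> tensor \<Rightarrow> tensor" where
  "covector_app J A w = (\<lambda>i. \<Sum>j\<in>indices J. w j * A (splice j i))"

lemma tensor_inner_einstein_app:
  "tensor_inner J w (einstein_app J I A X) = tensor_inner I (covector_app J A w) X"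
  by (simp add: tensor_inner_def einstein_app_def covector_app_def sum_distrib_left
      sum_distrib_right mult_ac sum.swap[of _ "indices J"])

lemma einstein_mult_splice:
  assumes "length J = length I" and "j \<in> indices J" and "i \<in> indices I"
  shows "einstein_mult J K I A B (splice j i)
    = (\<Sum>k\<in>indices K. A (splice j k) * B (splice k i))"
  using assms splice_in_indices[OF assms]
  by (simp add: einstein_mult_def fst_snd_indices_splice length_indices)

lemma covector_app_einstein_mult:
  assumes "length J = length I" and "i \<in> indices I"
  shows "covector_app J (einstein_mult J K I A B) w i
    = covector_app K B (covector_app J A w) i"
  using assms
  by (simp add: covector_app_def einstein_mult_splice sum_distrib_left
      sum_distrib_right mult_ac sum.swap[of _ "indices J"])

text \<open>As \<open>einstein_pow\<close> adds factors on the left, the covector meets the new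
  factor first; hence the induction for arbitrary \<open>w\<close> and the final commutation of
  iterates.\<close>

lemma covector_app_einstein_pow:
  assumes "i \<in> indices J"
  shows "covector_app J (einstein_pow J A p) w i = (covector_app J A ^^ p) w i"
proof (induction p arbitrary: w)
  case 0
  have "covector_app J (identity_tensor J) w i = (\<Sum>j\<in>indices J. if j = i then w j else 0)"
    unfolding covector_app_def
    using assms splice_in_indices[of J J _ i]
    by (intro sum.cong) (simp_all add: identity_tensor_def fst_snd_indices_splice length_indices)
  then show ?case using assms by simp
next
  case (Suc p)
  have "covector_app J (einstein_pow J A (Suc p)) w i = (covector_app J A ^^ p) (covector_app J A w) i"
    using assms by (simp add: covector_app_einstein_mult Suc)
  then show ?case by (simp add: funpow_swap1)
qed

lemma covector_app_cong:
  "(\<And>j. j \<in> indices J \<Longrightarrow> w j = w' j) \<Longrightarrow> covector_app J A w = covector_app J A w'"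
  by (simp add: covector_app_def)

text \<open>The unreachable target is \<open>w\<close> itself, starting from 0: reaching it would
  force the squared norm of \<open>w\<close> to be 0.\<close>

lemma not_reachable_if_annihilated:
  assumes w: "w \<in> tensors J" "w \<noteq> (\<lambda>_. 0)"
    and ann: "\<And>p k. k \<in> indices K \<Longrightarrow> covector_app J B ((covector_app J A ^^ p) w) k = 0"
  shows "\<not> reachable J K A B"
proof
  assume "reachable J K A B"
  then obtain t0 t1 where t: "t0 < t1" "reachable_on J K A B t0 t1"
    by (auto simp: reachable_def)
  have "(\<lambda>_. 0) \<in> tensors J" by (simp add: tensors_def)
  with t w obtain U X where X: "X t0 = (\<lambda>_. 0)" "X t1 = w"
    and step: "\<And>t. t \<in> {t0..t1 - 1} \<Longrightarrow> X (t + 1) =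
             (\<lambda>j. einstein_app J J A (X t) j + einstein_app J K B (U t) j)"
    unfolding reachable_on_def by meson
  \<comment> \<open>All \<open>p\<close> are treated at once, because moving \<open>A\<close> from
    the state to the covector turns \<open>p\<close> into \<open>Suc p\<close>; the input term
    vanishes by \<open>ann\<close>.\<close>
  have zero: "t0 + int s \<le> t1 \<Longrightarrow> tensor_inner J ((covector_app J A ^^ p) w) (X (t0 + int s)) = 0"
    for s p
  proof (induction s arbitrary: p)
    case 0
    then show ?case by (simp add: X tensor_inner_def)
  next
    case (Suc s)
    let ?w = "(covector_app J A ^^ p) w"
    have "X (t0 + int (Suc s)) = X (t0 + int s + 1)" by (simp add: algebra_simps)
    also have "\<dots> = (\<lambda>j. einstein_app J J A (X (t0 + int s)) j
        + einstein_app J K B (U (t0 + int s)) j)"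
      using Suc.prems by (intro step) auto
    finally have "tensor_inner J ?w (X (t0 + int (Suc s)))
      = tensor_inner J ?w (einstein_app J J A (X (t0 + int s)))
      + tensor_inner J ?w (einstein_app J K B (U (t0 + int s)))"
      by (simp add: tensor_inner_def distrib_left sum.distrib)
    also have "tensor_inner J ?w (einstein_app J K B (U (t0 + int s))) = 0"
      by (simp only: tensor_inner_einstein_app) (simp add: tensor_inner_def ann)
    also have "tensor_inner J ?w (einstein_app J J A (X (t0 + int s))) = 0"
      using Suc.IH[of "Suc p"] Suc.prems by (simp add: tensor_inner_einstein_app)
    finally show ?case by simp
  qed
  from zero[of "nat (t1 - t0)" 0] t X have "tensor_inner J w w = 0" by simp
  then have "\<forall>j\<in>indices J. w j = 0"
    by (simp add: tensor_inner_def sum_nonneg_eq_0_iff)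
  with w show False by (auto simp: tensors_def)
qed


subsection \<open>Vanishing mode singular values\<close>

lemma subtensor_norm_eq_0:
  assumes "tensor_norm (drop_mode m ds) (subtensor S m \<alpha>) = 0"
    and "m < length ds" and "l \<in> indices ds" and "l ! m = \<alpha>"
  shows "S l = 0"
proof -
  have "\<forall>i\<in>indices (drop_mode m ds). subtensor S m \<alpha> i = 0"
    using assms(1) by (simp add: tensor_norm_def sum_nonneg_eq_0_iff)
  then have "subtensor S m \<alpha> (drop_mode m l) = 0"
    using drop_mode_in_indices assms(3) by blast
  then show ?thesis
    using insert_drop_mode[of m l] assms length_indices[of l ds] by (simp add: subtensor_def)
qed

lemma mode_product_nth:
  assumes "U \<in> carrier_mat (ds ! m) (ds ! m)" and "l \<in> indices ds"
  shows "mode_product ds m T U l = (\<Sum>i<ds ! m. T (l[m := i]) * U $$ (l ! m, i))"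
  using assms by (simp add: mode_product_def)

text \<open>Orthonormality of the columns of \<open>U m\<close> recovers the core slice
  \<open>\<alpha>\<close>, which is zero. The other modes act on other positions and do not
  interfere.\<close>

lemma hosvd_annihilated:
  assumes H: "hosvd ds Y S U" and m: "m < length ds" and \<alpha>: "\<alpha> < ds ! m"
    and zero: "tensor_norm (drop_mode m ds) (subtensor S m \<alpha>) = 0"
    and l: "l \<in> indices ds"
  shows "(\<Sum>a<ds ! m. U m $$ (a, \<alpha>) * Y (l[m := a])) = 0"
proof -
  let ?step = "\<lambda>m T. mode_product ds m T (U m)"
  have U: "U r \<in> carrier_mat (ds ! r) (ds ! r)" if "r < length ds" for r
    using H that by (simp add: hosvd_def)
  have UtU: "transpose_mat (U m) * U m = 1\<^sub>m (ds ! m)"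
    using H m by (simp add: hosvd_def)
  \<comment> \<open>Factors in modes below \<open>m\<close> leave position \<open>m\<close> alone,
    so slice \<open>\<alpha>\<close> stays zero.\<close>
  have before: "\<forall>l\<in>indices ds. l ! m = \<alpha> \<longrightarrow> fold ?step [0..<r] S l = 0" if "r \<le> m" for r
    using that
  proof (induction r)
    case 0
    then show ?case using subtensor_norm_eq_0[OF zero m] by simp
  next
    case (Suc r)
    show ?case
    proof (intro ballI impI)
      fix l assume l: "l \<in> indices ds" "l ! m = \<alpha>"
      have "fold ?step [0..<r] S (l[r := i]) = 0" if "i < ds ! r" for i
        using Suc l that list_update_in_indices[OF l(1) that] by auto
      then show "fold ?step [0..<Suc r] S l = 0"
        using l Suc.prems m by (simp add: mode_product_nth[OF U])
    qed
  qed
  \<comment> \<open>Once mode \<open>m\<close> has been transformed, the invariant changes: every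
    fibre in mode \<open>m\<close> is orthogonal to column \<open>\<alpha>\<close> of
    \<open>U m\<close>.\<close>
  have after: "\<forall>l\<in>indices ds. (\<Sum>a<ds ! m. U m $$ (a, \<alpha>) * fold ?step [0..<r] S (l[m := a])) = 0"
    if "Suc m \<le> r" "r \<le> length ds" for r
    using that
  proof (induction r rule: dec_induct)
    case base
    show ?case
    proof
      fix l assume l: "l \<in> indices ds"
      let ?T = "fold ?step [0..<m] S"
      have ml: "m < length l" using m l by (simp add: length_indices)
      have "(\<Sum>a<ds ! m. U m $$ (a, \<alpha>) * fold ?step [0..<Suc m] S (l[m := a]))
        = (\<Sum>a<ds ! m. U m $$ (a, \<alpha>) * (\<Sum>i<ds ! m. ?T (l[m := i]) * U m $$ (a, i)))"
        using m l ml by (intro sum.cong)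
          (auto simp: mode_product_nth[OF U] list_update_in_indices)
      \<comment> \<open>Exchanging the sums makes the inner one the entry
        \<open>(\<alpha>, i)\<close> of the identity matrix.\<close>
      also have "\<dots> = (\<Sum>i<ds ! m. ?T (l[m := i]) * (\<Sum>a<ds ! m. U m $$ (a, \<alpha>) * U m $$ (a, i)))"
        unfolding sum_distrib_left by (subst sum.swap) (simp add: mult_ac)
      also have "\<dots> = (\<Sum>i<ds ! m. ?T (l[m := i]) * (if i = \<alpha> then 1 else 0))"
      proof (intro sum.cong refl)
        fix i assume i: "i \<in> {..<ds ! m}"
        have "(transpose_mat (U m) * U m) $$ (\<alpha>, i) = (\<Sum>a<ds ! m. U m $$ (a, \<alpha>) * U m $$ (a, i))"
          using U[OF m] i \<alpha> by (simp add: scalar_prod_def atLeast0LessThan)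
        then show "?T (l[m := i]) * (\<Sum>a<ds ! m. U m $$ (a, \<alpha>) * U m $$ (a, i))
            = ?T (l[m := i]) * (if i = \<alpha> then 1 else 0)"
          using i \<alpha> by (auto simp: UtU)
      qed
      also have "\<dots> = ?T (l[m := \<alpha>])"
        using \<alpha> by (simp add: if_distrib[of "\<lambda>x. _ * x"] cong: if_cong)
      also have "\<dots> = 0"
        using before[of m] l \<alpha> ml by (simp add: list_update_in_indices)
      finally show "(\<Sum>a<ds ! m. U m $$ (a, \<alpha>) * fold ?step [0..<Suc m] S (l[m := a])) = 0" .
    qed
  next
    case (step r)
    show ?case
    proof
      fix l assume l: "l \<in> indices ds"
      let ?T = "fold ?step [0..<r] S"
      \<comment> \<open>Now \<open>r > m\<close>, so updates at \<open>r\<close> and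
        \<open>m\<close> commute and the contraction in mode \<open>m\<close> can be carried out
        first.\<close>
      have "(\<Sum>a<ds ! m. U m $$ (a, \<alpha>) * fold ?step [0..<Suc r] S (l[m := a]))
        = (\<Sum>a<ds ! m. U m $$ (a, \<alpha>) * (\<Sum>i<ds ! r. ?T (l[r := i, m := a]) * U r $$ (l ! r, i)))"
        using step l by (intro sum.cong)
          (auto simp: mode_product_nth[OF U] list_update_in_indices list_update_swap[of m r])
      also have "\<dots> = (\<Sum>i<ds ! r. U r $$ (l ! r, i) * (\<Sum>a<ds ! m. U m $$ (a, \<alpha>) * ?T (l[r := i, m := a])))"
        unfolding sum_distrib_left by (subst sum.swap) (simp add: mult_ac)
      also have "\<dots> = 0"
        using step l by (simp add: list_update_in_indices)
      finally show "(\<Sum>a<ds ! m. U m $$ (a, \<alpha>) * fold ?step [0..<Suc r] S (l[m := a])) = 0" .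
    qed
  qed
  have "Y = fold ?step [0..<length ds] S" using H by (simp add: hosvd_def)
  then show ?thesis using after[of "length ds"] m l by simp
qed

section \<open>Reading blocks along one axis\<close>

text \<open>The second index \<open>s\<close> is chosen from \<open>p\<close> and \<open>k\<close>
  alone, before \<open>j\<close>, so one \<open>s\<close> serves all terms of a sum over
  \<open>j\<close>.\<close>

lemma reachability_tensor_block:
  assumes "length J = length K" and "p < prod_list J" and "k \<in> indices K"
  obtains s where "s \<in> indices (map2 (*) J K)"
    and "\<And>j. j \<in> indices J \<Longrightarrow> reachability_tensor J K A B (splice j s)
      = einstein_mult J J K (einstein_pow J A p) B (splice j k)"
proof -
  from block_position_surj[OF assms(2)]
  obtain x where x: "x \<in> indices J" "block_position J x = p" by blast
  from block_index_exists[OF assms(1) x(1) assms(3)]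
  obtain s where s: "s \<in> indices (map2 (*) J K)" "map2 (div) s K = x" "map2 (mod) s K = k"
    by blast
  show ?thesis
  proof
    fix j assume j: "j \<in> indices J"
    have "splice j s \<in> indices (splice J (map2 (*) J K))"
      using assms(1) j s(1) by (intro splice_in_indices) auto
    moreover have "length j = length s"
      using j s(1) assms(1) by (auto dest!: length_indices)
    ultimately show "reachability_tensor J K A B (splice j s)
      = einstein_mult J J K (einstein_pow J A p) B (splice j k)"
      using x s by (simp add: reachability_tensor_def row_block_tensor_def fst_snd_indices_splice)
  qed (fact s(1))
qed

text \<open>The vector \<open>u\<close> placed on the axis through the zero multi-index in direction
  \<open>q\<close>. Pairing with it is a contraction along a single fibre, the kind of sum that
  \<open>hosvd_annihilated\<close> controls.\<close>

definition axis_covector :: "nat list \<Rightarrow> nat \<Rightarrow> (nat \<Rightarrow> real) \<Rightarrow> tensor" where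
  "axis_covector J q u =
     (\<lambda>j. if j \<in> indices J \<and> j = (replicate (length J) 0)[q := j ! q] then u (j ! q) else 0)"

lemma axis_in_indices:
  "\<forall>d\<in>set J. d > 0 \<Longrightarrow> x < J ! q \<Longrightarrow> (replicate (length J) 0)[q := x] \<in> indices J"
  by (intro list_update_in_indices) (auto simp: indices_def list_all2_conv_all_nth)

lemma sum_axis_covector:
  assumes "\<forall>d\<in>set J. d > 0" and "q < length J"
  shows "(\<Sum>j\<in>indices J. axis_covector J q u j * f j)
    = (\<Sum>x<J ! q. u x * f ((replicate (length J) 0)[q := x]))"
proof -
  let ?e = "\<lambda>x. (replicate (length J) 0)[q := x :: nat]"
  have e: "?e x ! q = x" for x using assms by simp
  then have inj: "inj_on ?e {..<J ! q}" by (metis inj_onI)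
  have "(\<Sum>j\<in>indices J. axis_covector J q u j * f j)
    = (\<Sum>j\<in>?e ` {..<J ! q}. axis_covector J q u j * f j)"
    using assms axis_in_indices[OF assms(1)] indices_nth_less[of _ J q]
    by (intro sum.mono_neutral_right) (auto simp: axis_covector_def)
  also have "\<dots> = (\<Sum>x<J ! q. axis_covector J q u (?e x) * f (?e x))"
    by (simp add: sum.reindex[OF inj])
  finally show ?thesis
    using axis_in_indices[OF assms(1)] e by (simp add: axis_covector_def)
qed

theorem corollary5p10:
  fixes N n :: nat and J K :: "nat list" and A B S :: tensor and U :: "nat \<Rightarrow> real mat"
  assumes "N \<ge> 1" and "length J = N" and "length K = N"
    and "\<forall>d\<in>set J. d > 0" and "\<forall>d\<in>set K. d > 0"
    and "A \<in> tensors (splice J J)" and "B \<in> tensors (splice J K)"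
    and "hosvd (splice J (map2 (*) J K)) (reachability_tensor J K A B) S U"
    and "odd n" and "n \<le> 2 * N - 1"
    and "0 \<in> mode_singular_values (splice J (map2 (*) J K)) S (n - 1)"
  shows "\<not> reachable J K A B"
proof -
  let ?ds = "splice J (map2 (*) J K)"
  \<comment> \<open>The zero-based mode \<open>n - 1 = 2 * q\<close> is the first index of pair
    \<open>q\<close>.\<close>
  obtain q where n: "n = 2 * q + 1" using \<open>odd n\<close> by (rule oddE)
  have q: "q < length J" using n assms by simp
  have len: "length J = length K" using assms by simp
  have ds_nth: "?ds ! (2 * q) = J ! q"
    using splice_nth_even[of J "map2 (*) J K" q] q len by simp
  have m: "2 * q < length ?ds" using q len by simp
  from assms(11) n ds_nth obtain \<alpha> where \<alpha>: "\<alpha> < J ! q"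
    "tensor_norm (drop_mode (2 * q) ?ds) (subtensor S (2 * q) \<alpha>) = 0"
    by (auto simp: mode_singular_values_def)
  define u where "u x = U (2 * q) $$ (x, \<alpha>)" for x
  define w where "w = axis_covector J q u"
  let ?e = "\<lambda>x. (replicate (length J) 0)[q := x :: nat]"
  have e: "?e x \<in> indices J" if "x < J ! q" for x
    using axis_in_indices[OF assms(4) that] .
  have low: "covector_app J B ((covector_app J A ^^ p) w) k = 0"
    if k: "k \<in> indices K" and p: "p < card (indices J)" for p k
  proof -
    from p have "p < prod_list J" by (simp add: card_indices)
    from reachability_tensor_block[OF len this k, of A B]
    obtain s where s: "s \<in> indices (map2 (*) J K)"
      "\<And>j. j \<in> indices J \<Longrightarrow> reachability_tensor J K A B (splice j s)
        = einstein_mult J J K (einstein_pow J A p) B (splice j k)"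
      by blast
    have ls: "length s = length J" using length_indices[OF s(1)] len by simp
    \<comment> \<open>The value \<open>\<alpha>\<close> on the axis only supplies a valid index; the
      contraction overwrites position \<open>2 * q\<close>.\<close>
    have "splice (?e \<alpha>) s \<in> indices ?ds"
      using s(1) e[OF \<alpha>(1)] len by (intro splice_in_indices) auto
    from hosvd_annihilated[OF assms(8) m _ \<alpha>(2) this]
    have 0: "(\<Sum>x<J ! q. u x * reachability_tensor J K A B (splice (?e x) s)) = 0"
      using \<alpha>(1) ls by (simp add: ds_nth u_def splice_update_even)
    have "covector_app J B ((covector_app J A ^^ p) w) k
      = covector_app J B (covector_app J (einstein_pow J A p) w) k"
      \<comment> \<open>Power and iterate are known to agree at valid indices, the only ones that
        the product with \<open>B\<close> reads.\<close>
      using covector_app_cong[of J "covector_app J (einstein_pow J A p) w"]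
      by (simp add: covector_app_einstein_pow)
    also have "\<dots> = covector_app J (einstein_mult J J K (einstein_pow J A p) B) w k"
      using covector_app_einstein_mult[OF len k] by simp
    also have "\<dots> = (\<Sum>x<J ! q. u x * einstein_mult J J K (einstein_pow J A p) B (splice (?e x) k))"
      using sum_axis_covector[OF assms(4) q] by (simp add: covector_app_def w_def)
    also have "\<dots> = 0" using 0 s(2) e by simp
    finally show ?thesis .
  qed
  show ?thesis
  proof (rule not_reachable_if_annihilated)
    show "w \<in> tensors J" by (simp add: w_def axis_covector_def tensors_def)
    \<comment> \<open>The diagonal entry says that column \<open>\<alpha>\<close> has norm one, so
      \<open>u\<close> is not zero.\<close>
    have "(transpose_mat (U (2 * q)) * U (2 * q)) $$ (\<alpha>, \<alpha>) = 1"
      "U (2 * q) \<in> carrier_mat (J ! q) (J ! q)"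
      using assms(8) m \<alpha>(1) by (auto simp: hosvd_def ds_nth)
    then have "(\<Sum>x<J ! q. u x * u x) = 1"
      using \<alpha>(1) by (simp add: u_def scalar_prod_def atLeast0LessThan)
    then obtain x where x: "x < J ! q" "u x \<noteq> 0"
      by (metis (mono_tags, lifting) lessThan_iff mult_zero_left sum.neutral zero_neq_one)
    then have "w (?e x) \<noteq> 0" using e q by (simp add: w_def axis_covector_def)
    then show "w \<noteq> (\<lambda>_. 0)" by auto
    show "covector_app J B ((covector_app J A ^^ p) w) k = 0" if "k \<in> indices K" for p k
      unfolding covector_app_def[of J B]
    \<comment> \<open>The blocks give the first \<open>card (indices J)\<close> pairings; the
      recurrence in \<open>p\<close> is the definition of \<open>covector_app\<close>.\<close>
    proof (rule krylov_annihilation[where M = "\<lambda>j i. A (splice j i)"])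
      show "(\<Sum>j\<in>indices J. (covector_app J A ^^ p) w j * B (splice j k)) = 0"
        if "p < card (indices J)" for p
        using low[OF \<open>k \<in> indices K\<close> that] by (simp add: covector_app_def[of J B])
    qed (simp_all add: covector_app_def)
  qed
qed

end
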